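(* Let $M=\max_{0<r\le1}J(r)$. In the absence of body forces, the central difference scheme $$U^{k+1}_{l,h}=-U^{k-1}_{l,h}+(2+\Delta t^2A)U^k_{l,h}$$ for the spatially discretized (piecewise linear interpolation, $\rho=1$) linearized peridynamic equation is stable as long as the time step $\Delta t>0$ satisfies $$\Delta t\le\frac{h}{\sqrt{\mathbb{C}+2f'(0)\dfrac{Mh^2}{\epsilon^2}}}.$$
   Context: $D=[a,b]\subset\mathbb{R}$ is a bounded interval, $\epsilon>0$ is the horizon, and $\partial D^\epsilon=(a-\epsilon,a+\epsilon)\cup(b-\epsilon,b+\epsilon)$. The function $f:[0,\infty)\to\mathbb{R}$ is positive (for $r>0$), smooth and concave with $\lim_{r\to0^+}f(r)/r=f'(0)$ and $\lim_{r\to\infty}f(r)<\infty$. The influence function $J(|\xi|)$ is (measurable,) nonnegative and bounded on $[-1,1]$ and zero for $\xi$ outside $[-1,1]$. The elastic constant is $\mathbb{C}=\int_{-1}^1J(|z|)f'(0)|z|\,dz>0$. Mesh: $h>0$ is the distance between mesh points, $x_i=ih$, $K=\{i\in\mathbb{Z}:ih\in\overline D\}$, $K_\epsilon=\{i\in\mathbb{Z}:ih\in\overline{\partial D^\epsilon}\}$; $\overline D$ and $\overline{\partial D^\epsilon}$ are unions of mesh elements and $\epsilon=mh$ with $m$ a positive integer. $\phi_i$ is the piecewise linear hat function at $x_i$ (equal to $1$ at $x_i$, $0$ at all other nodes, linear on each mesh element). The matrix $A=(a_{ij})_{i,j\in K}$ is defined by $a_{ij}=\bar a_{ij}$ for $j\ne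 i$ and $a_{ii}=-\sum_{k\in K\cup K_\epsilon,\,k\ne i}\bar a_{ik}$, where $$\bar a_{ij}=\frac{2}{\epsilon^2}f'(0)\int_{x_i-\epsilon}^{x_i+\epsilon}\frac{\phi_j(y)\,J(|y-x_i|/\epsilon)}{|y-x_i|}\,dy .$$ It is the matrix of the semi-discrete linearized peridynamic evolution $\ddot U_{l,h}=AU_{l,h}$ with $\rho=1$, zero body force and zero displacement at the nodes of $K_\epsilon$; $U^k_{l,h}\in\mathbb{R}^K$ is the vector of nodal displacements at time $k\Delta t$. Stability means: for every eigenvector $\nu$ of $A$ and every (real or complex) $\xi$ for which $U^k_{l,h}=\xi^k\nu$ (with $\xi^k$ the $k$-th power) solves the scheme, one has $|\xi|\le1$. *)

theory Defs
  imports "HOL-Analysis.Analysis" "Jordan_Normal_Form.Char_Poly"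
begin

text \<open>
  Throughout, \<open>c\<close> stands for the number $f'(0)$, the one-sided derivative at 0 of the
  potential \<open>f\<close> on the half-line.
\<close>

definition smooth_on_halfline :: "(real \<Rightarrow> real) \<Rightarrow> bool" where
  "smooth_on_halfline f \<longleftrightarrow>
     (\<exists>g :: nat \<Rightarrow> real \<Rightarrow> real.
        (\<forall>r\<ge>0. g 0 r = f r) \<and>
        (\<forall>n. \<forall>r\<ge>0. (g n has_real_derivative g (Suc n) r) (at r within {0..})))"

definition boundary_layer :: "real \<Rightarrow> real \<Rightarrow> real \<Rightarrow> real set" where
  "boundary_layer a b \<epsilon> = {a - \<epsilon><..<a + \<epsilon>} \<union> {b - \<epsilon><..<b + \<epsilon>}"

definition mesh_elements :: "real \<Rightarrow> real set set" where
  "mesh_elements h = range (\<lambda>i :: int. {of_int i * h .. of_int (i + 1) * h})"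

definition union_of_mesh_elements :: "real \<Rightarrow> real set \<Rightarrow> bool" where
  "union_of_mesh_elements h S \<longleftrightarrow> (\<exists>E \<subseteq> mesh_elements h. S = \<Union> E)"

definition mesh_indices :: "real \<Rightarrow> real set \<Rightarrow> int set" where
  "mesh_indices h S = {i. of_int i * h \<in> closure S}"

definition hat :: "real \<Rightarrow> int \<Rightarrow> real \<Rightarrow> real" where
  "hat h i y = max 0 (1 - \<bar>y - of_int i * h\<bar> / h)"

text \<open>The next two facts determine \<open>hat h i\<close> as the nodal basis function at \<open>i h\<close>.\<close>

lemma hat_node:
  assumes "h > 0"
  shows "hat h i (of_int j * h) = (if j = i then 1 else 0)"
proof (cases "j = i")
  case False
  have "of_int j * h - of_int i * h = of_int (j - i) * h"
    by (simp add: algebra_simps)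
  then have "\<bar>of_int j * h - of_int i * h\<bar> / h = \<bar>of_int (j - i)\<bar>"
    using assms by (simp add: abs_mult)
  moreover have "\<bar>of_int (j - i) :: real\<bar> \<ge> 1"
    using False by linarith
  ultimately show ?thesis
    using False by (simp add: hat_def)
qed (simp add: hat_def)

lemma hat_affine_on_element:
  assumes "h > 0"
  shows "\<exists>p q. \<forall>y \<in> {of_int k * h .. of_int (k + 1) * h}. hat h i y = p + q * y"
proof -
  consider "k \<ge> i + 1" | "k = i" | "k = i - 1" | "k + 1 \<le> i - 1"
    by linarith
  then show ?thesis
  proof cases
    case 1
    have "hat h i y = 0 + 0 * y" if "y \<in> {of_int k * h .. of_int (k + 1) * h}" for y
    proof -
      have "of_int (i + 1) * h \<le> of_int k * h"
        using 1 assms by (intro mult_right_mono) (simp_all only: of_int_le_iff less_imp_le)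
      then have "h \<le> y - of_int i * h"
        using that by (simp add: algebra_simps)
      then show ?thesis
        using assms by (simp add: hat_def field_simps)
    qed
    then show ?thesis by blast
  next
    case 2
    have "hat h i y = (1 + of_int i) + (- 1 / h) * y"
      if "y \<in> {of_int k * h .. of_int (k + 1) * h}" for y
      using that 2 assms by (simp add: hat_def field_simps max_def)
    then show ?thesis by blast
  next
    case 3
    have "hat h i y = (1 - of_int i) + (1 / h) * y"
      if "y \<in> {of_int k * h .. of_int (k + 1) * h}" for y
      using that 3 assms by (simp add: hat_def field_simps max_def abs_if)
    then show ?thesis by blast
  next
    case 4
    have "hat h i y = 0 + 0 * y" if "y \<in> {of_int k * h .. of_int (k + 1) * h}" for y
    proof -
      have "of_int (k + 1) * h \<le> of_int (i - 1) * h"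
        using 4 assms by (intro mult_right_mono) (simp_all only: of_int_le_iff less_imp_le)
      then have "h \<le> of_int i * h - y"
        using that by (simp add: algebra_simps)
      then show ?thesis
        using assms by (simp add: hat_def field_simps)
    qed
    then show ?thesis by blast
  qed
qed

definition elastic_constant :: "real \<Rightarrow> (real \<Rightarrow> real) \<Rightarrow> real" where
  "elastic_constant c J = (LINT z:{-1..1}|lebesgue. J \<bar>z\<bar> * c * \<bar>z\<bar>)"

definition abar :: "real \<Rightarrow> (real \<Rightarrow> real) \<Rightarrow> real \<Rightarrow> real \<Rightarrow> int \<Rightarrow> int \<Rightarrow> real" where
  "abar c J h \<epsilon> i j =
     2 / \<epsilon>\<^sup>2 * c *
     (LINT y:{of_int i * h - \<epsilon> .. of_int i * h + \<epsilon>}|lebesgue.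
        hat h j y * J (\<bar>y - of_int i * h\<bar> / \<epsilon>) / \<bar>y - of_int i * h\<bar>)"

text \<open>
  In the diagonal entry the sum also runs over the nodes \<open>K\<epsilon>\<close> of the boundary layer, although
  rows and columns of the matrix are indexed by \<open>K\<close> only.
\<close>

definition stiffness_entry ::
  "real \<Rightarrow> (real \<Rightarrow> real) \<Rightarrow> real \<Rightarrow> real \<Rightarrow> int set \<Rightarrow> int set \<Rightarrow> int \<Rightarrow> int \<Rightarrow> real" where
  "stiffness_entry c J h \<epsilon> K K\<epsilon> i j =
     (if j = i then - (\<Sum>k \<in> (K \<union> K\<epsilon>) - {i}. abar c J h \<epsilon> i k)
      else abar c J h \<epsilon> i j)"

text \<open>
  Matrices are indexed by initial segments of the naturals, so the finite set \<open>K\<close> of integers is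
  enumerated in increasing order.
\<close>

definition stiffness_matrix ::
  "real \<Rightarrow> (real \<Rightarrow> real) \<Rightarrow> real \<Rightarrow> real \<Rightarrow> real \<Rightarrow> real \<Rightarrow> real Matrix.mat" where
  "stiffness_matrix c J a b h \<epsilon> =
     (let K = mesh_indices h {a..b};
          K\<epsilon> = mesh_indices h (boundary_layer a b \<epsilon>);
          node = (\<lambda>r. sorted_list_of_set K ! r)
      in Matrix.mat (card K) (card K)
           (\<lambda>(r, s). stiffness_entry c J h \<epsilon> K K\<epsilon> (node r) (node s)))"

definition solves_central_difference ::
  "real \<Rightarrow> complex Matrix.mat \<Rightarrow> (nat \<Rightarrow> complex Matrix.vec) \<Rightarrow> bool" where
  "solves_central_difference \<Delta>t A U \<longleftrightarrow>
     (\<forall>k\<ge>1. U (k + 1) =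
        - U (k - 1) + (2 \<cdot>\<^sub>m 1\<^sub>m (dim_row A) + complex_of_real (\<Delta>t\<^sup>2) \<cdot>\<^sub>m A) *\<^sub>v U k)"

definition central_difference_stable :: "real \<Rightarrow> real Matrix.mat \<Rightarrow> bool" where
  "central_difference_stable \<Delta>t A \<longleftrightarrow>
     (let A\<^sub>C = map_mat complex_of_real A in
      \<forall>\<nu> \<mu> \<xi>. eigenvector A\<^sub>C \<nu> \<mu> \<longrightarrow>
        solves_central_difference \<Delta>t A\<^sub>C (\<lambda>k. \<xi> ^ k \<cdot>\<^sub>v \<nu>) \<longrightarrow> cmod \<xi> \<le> 1)"

end

theory Submission
  imports Defs
begin

text \<open>
  The change of variables \<open>y = i h + \<epsilon> z\<close> shows that \<open>abar c J h \<epsilon> i j\<close> is a positive multiple of a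
  weight that depends only on \<open>j - i\<close>, is even in it, and is nonnegative. So the stiffness matrix is
  symmetric with nonnegative off-diagonal entries. Its diagonal entry is minus the sum of all the
  bonds of the node, those to the boundary layer included, and so dominates the rest of its row.
  Such a matrix has real eigenvalues, and by Gershgorin's theorem
  (\<open>dominant_eigenvalue_bounds\<close>) they lie in \<open>[-2 S, 0]\<close>, where \<open>S\<close> bounds the row sums of bonds.

  The value of \<open>S\<close> comes from \<open>sum_bond_weight_le\<close>. The hat functions form a partition of unity, so
  those of the nodes other than \<open>i\<close> add up to at most \<open>min 1 (m \<bar>z\<bar>)\<close>. The row sum is therefore at
  most \<open>2 c / \<epsilon>\<^sup>2\<close> times the integral of \<open>min 1 (m \<bar>z\<bar>) J \<bar>z\<bar> / \<bar>z\<bar>\<close> over \<open>[-1, 1]\<close>.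
  For \<open>\<bar>z\<bar> > 1 / m\<close> the integrand is at most \<open>m\<^sup>2 J \<bar>z\<bar> \<bar>z\<bar>\<close>, which produces the elastic constant;
  for \<open>\<bar>z\<bar> \<le> 1 / m\<close> it is at most \<open>m M\<close> on an interval of length \<open>2 / m\<close>, which produces the
  correction with \<open>M\<close>. Together, \<open>S = 2 Q / h\<^sup>2\<close>, where \<open>Q\<close> is the number under the
  root in the bound on the time step.

  Along an eigenvector with eigenvalue \<open>\<mu>\<close>, a solution \<open>\<xi> ^ k\<close> of the scheme satisfies
  \<open>\<xi>\<^sup>2 + 1 = (2 + \<Delta>t\<^sup>2 \<mu>) \<xi>\<close>. The two roots have product 1, so both lie in the closed unit disc
  exactly when they lie on the circle, which happens if \<open>-4 \<le> \<Delta>t\<^sup>2 \<mu> \<le> 0\<close>. The condition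
  \<open>\<Delta>t\<^sup>2 \<le> h\<^sup>2 / Q\<close> gives this, because \<open>-\<mu> \<le> 2 S = 4 Q / h\<^sup>2\<close>.
\<close>

section \<open>Hat functions on the reference mesh\<close>

lemma hat_rescale:
  assumes "h > 0"
  shows "hat h j (of_int i * h + real m * h * z) = hat 1 (j - i) (real m * z)"
proof -
  have "of_int i * h + real m * h * z - of_int j * h = (real m * z - of_int (j - i)) * h"
    by (simp add: algebra_simps)
  then have "\<bar>of_int i * h + real m * h * z - of_int j * h\<bar> / h = \<bar>real m * z - of_int (j - i)\<bar>"
    using assms by (simp add: abs_mult)
  then show ?thesis
    by (simp add: hat_def)
qed

lemma hat_nonneg: "hat h i y \<ge> 0"
  by (simp add: hat_def)

lemma hat_reflect: "hat 1 d (- s) = hat 1 (- d) s"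
proof -
  have "\<bar>- s - of_int d\<bar> = \<bar>s - of_int (- d)\<bar>"
    by linarith
  then show ?thesis
    by (simp add: hat_def)
qed

text \<open>
  At a point only the hats of the two ends of its mesh element are nonzero, and these two add up to
  1. The bound is an inequality because \<open>D\<close> may miss one of these nodes.
\<close>

lemma sum_hat_le_one:
  assumes "finite D"
  shows "(\<Sum>d\<in>D. hat 1 d s) \<le> 1"
proof -
  define n where "n = \<lfloor>s\<rfloor>"
  have n: "of_int n \<le> s" "s < of_int n + 1"
    unfolding n_def by linarith+
  have zero: "hat 1 d s = 0" if "d \<notin> {n, n + 1}" for d
  proof -
    have "d \<le> n - 1 \<or> d \<ge> n + 2"
      using that by auto
    then have "real_of_int d \<le> real_of_int (n - 1) \<or> real_of_int d \<ge> real_of_int (n + 2)"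
      by (simp only: of_int_le_iff)
    then show ?thesis
      using n by (auto simp: hat_def)
  qed
  have "(\<Sum>d\<in>D. hat 1 d s) = (\<Sum>d\<in>D \<inter> {n, n + 1}. hat 1 d s)"
    using assms by (intro sum.mono_neutral_right) (auto intro: zero)
  also have "\<dots> \<le> (\<Sum>d\<in>{n, n + 1}. hat 1 d s)"
    by (intro sum_mono2) (auto simp: hat_nonneg)
  also have "\<dots> = 1"
    using n by (auto simp: hat_def)
  finally show ?thesis .
qed

text \<open>
  The missing hat at the origin takes up \<open>1 - \<bar>s\<bar>\<close> of the partition of unity near 0 and leaves \<open>\<bar>s\<bar>\<close> to
  the others. This factor is what cancels the singularity \<open>1 / \<bar>z\<bar>\<close> of the bond weights.
\<close>

lemma sum_hat_off_origin:
  assumes "finite D" "0 \<notin> D"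
  shows "(\<Sum>d\<in>D. hat 1 d s) \<le> min 1 \<bar>s\<bar>"
proof -
  have "hat 1 0 s + (\<Sum>d\<in>D. hat 1 d s) \<le> 1"
    using sum_hat_le_one[of "insert 0 D" s] assms by simp
  moreover have "hat 1 0 s \<ge> 1 - \<bar>s\<bar>" "hat 1 0 s \<ge> 0"
    by (simp_all add: hat_def)
  ultimately show ?thesis by linarith
qed

section \<open>Bond weights\<close>

text \<open>
  This is the integral in \<open>abar\<close> between nodes at distance \<open>d\<close> mesh widths, in units in which the
  horizon is 1. The nodes are then the multiples of \<open>1 / m\<close>, whence the argument \<open>m z\<close> of the hat
  with unit spacing.
\<close>

definition bond_weight :: "nat \<Rightarrow> (real \<Rightarrow> real) \<Rightarrow> int \<Rightarrow> real" where
  "bond_weight m J d = (LINT z:{-1..1}|lebesgue. hat 1 d (real m * z) * J \<bar>z\<bar> / \<bar>z\<bar>)"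

text \<open>
  The factor \<open>\<epsilon>\<close> from the change of variables cancels the \<open>\<epsilon>\<close> in the distance \<open>\<bar>y - i h\<bar> = \<epsilon> \<bar>z\<bar>\<close>, so
  the weights depend on the mesh through the ratio \<open>m\<close> alone.
\<close>

lemma abar_eq_bond_weight:
  assumes "h > 0" "m > 0" "\<epsilon> = real m * h"
  shows "abar c J h \<epsilon> i j = 2 / \<epsilon>\<^sup>2 * c * bond_weight m J (j - i)"
proof -
  have \<epsilon>: "\<epsilon> > 0"
    using assms by simp
  have "indicator {of_int i * h - \<epsilon> .. of_int i * h + \<epsilon>} (of_int i * h + \<epsilon> * z) = (indicator {-1..1} z :: real)" for z
  proof -
    have "- \<epsilon> \<le> \<epsilon> * z \<longleftrightarrow> -1 \<le> z" "\<epsilon> * z \<le> \<epsilon> \<longleftrightarrow> z \<le> 1"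
      using \<epsilon> mult_le_cancel_left_pos[of \<epsilon> "-1" z] by auto
    then show ?thesis
      by (auto simp: indicator_def)
  qed
  moreover have "\<epsilon> * (hat h j (of_int i * h + \<epsilon> * z) * J (\<bar>of_int i * h + \<epsilon> * z - of_int i * h\<bar> / \<epsilon>)
        / \<bar>of_int i * h + \<epsilon> * z - of_int i * h\<bar>)
      = hat 1 (j - i) (real m * z) * J \<bar>z\<bar> / \<bar>z\<bar>" for z
    using \<epsilon> hat_rescale[OF assms(1), of j i m z] by (simp add: abs_mult assms(3)[symmetric])
  ultimately have integrand: "\<epsilon> * (indicator {of_int i * h - \<epsilon> .. of_int i * h + \<epsilon>} (of_int i * h + \<epsilon> * z) *
        (hat h j (of_int i * h + \<epsilon> * z) * J (\<bar>of_int i * h + \<epsilon> * z - of_int i * h\<bar> / \<epsilon>)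
          / \<bar>of_int i * h + \<epsilon> * z - of_int i * h\<bar>))
      = indicator {-1..1} z * (hat 1 (j - i) (real m * z) * J \<bar>z\<bar> / \<bar>z\<bar>)" for z
    by (metis mult.left_commute)
  have "(LINT y:{of_int i * h - \<epsilon> .. of_int i * h + \<epsilon>}|lebesgue.
        hat h j y * J (\<bar>y - of_int i * h\<bar> / \<epsilon>) / \<bar>y - of_int i * h\<bar>) = bond_weight m J (j - i)"
    unfolding bond_weight_def set_lebesgue_integral_def
    by (subst lebesgue_integral_real_affine[OF less_imp_neq[OF \<epsilon>, symmetric], of _ "of_int i * h"])
      (simp only: real_scaleR_def abs_of_pos[OF \<epsilon>] integrand flip: integral_mult_right_zero)
  then show ?thesis
    by (simp add: abar_def)
qed

text \<open>Reflecting \<open>z\<close> exchanges the hats at \<open>d\<close> and \<open>-d\<close>; this is the symmetry of the stiffness matrix.\<close>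

lemma bond_weight_even: "bond_weight m J (- d) = bond_weight m J d"
proof -
  have "indicator {-1..1} (- z) = (indicator {-1..1} z :: real)" for z :: real
    by (auto simp: indicator_def)
  then show ?thesis
    unfolding bond_weight_def set_lebesgue_integral_def
    by (subst lebesgue_integral_real_affine[of "-1" _ 0]) (simp_all add: hat_reflect)
qed

text \<open>
  Since \<open>min 1 t \<le> t\<close> and, for \<open>t \<ge> 1\<close>, \<open>min 1 t \<le> t\<^sup>2\<close>, the sum of the integrands is bounded by
  \<open>m M\<close> within distance \<open>1 / m\<close> of the origin and by \<open>m\<^sup>2 J \<bar>z\<bar> \<bar>z\<bar>\<close> beyond. Adding the two bounds on the
  whole interval gives a right-hand side with the first moment of \<open>J\<close>, which is the elastic constant
  up to the factor \<open>c\<close>.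
\<close>

lemma sum_bond_weight_le:
  fixes J :: "real \<Rightarrow> real"
  assumes "m > 0" and fin: "finite D" "0 \<notin> D"
    and meas: "(\<lambda>\<xi>. J \<bar>\<xi>\<bar>) \<in> borel_measurable lebesgue"
    and J: "\<And>r. 0 \<le> r \<Longrightarrow> r \<le> 1 \<Longrightarrow> 0 \<le> J r"
    and M: "\<And>r. 0 < r \<Longrightarrow> r \<le> 1 \<Longrightarrow> J r \<le> M"
  shows "(\<Sum>d\<in>D. bond_weight m J d) \<le> (real m)\<^sup>2 * (LINT z:{-1..1}|lebesgue. J \<bar>z\<bar> * \<bar>z\<bar>) + 2 * M"
proof -
  define g where "g d z = hat 1 d (real m * z) * J \<bar>z\<bar> / \<bar>z\<bar>" for d z
  have hat_meas: "(\<lambda>z. hat 1 d (real m * z)) \<in> borel_measurable lebesgue" for d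
    unfolding hat_def by (intro measurable_completion) measurable
  have abs_meas: "(\<lambda>z::real. \<bar>z\<bar>) \<in> borel_measurable lebesgue"
    by (intro measurable_completion) measurable
  have M0: "M \<ge> 0"
    using J[of 1] M[of 1] by simp
  have int: "set_integrable lebesgue {-1..1} F"
    if "F \<in> borel_measurable lebesgue" "\<And>z. z \<in> {-1..1} \<Longrightarrow> \<bar>F z\<bar> \<le> B" for F :: "real \<Rightarrow> real" and B
    unfolding set_integrable_def
    by (rule integrableI_bounded_set_indicator[where B = B]) (use that in auto)
  have Jz: "0 \<le> J \<bar>z\<bar>" "z \<noteq> 0 \<Longrightarrow> J \<bar>z\<bar> \<le> M" if "z \<in> {-1..1}" for z
    using J[of "\<bar>z\<bar>"] M[of "\<bar>z\<bar>"] that by auto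
  have int_g: "set_integrable lebesgue {-1..1} (g d)" if "d \<in> D" for d
  proof (rule int)
    show "g d \<in> borel_measurable lebesgue"
      unfolding g_def using hat_meas meas abs_meas by (intro borel_measurable_divide borel_measurable_times)
    show "\<bar>g d z\<bar> \<le> real m * M" if z: "z \<in> {-1..1}" for z
    proof (cases "z = 0")
      case False
      \<comment> \<open>This estimate keeps the integrand bounded in spite of the division by \<open>\<bar>z\<bar>\<close>.\<close>
      have "hat 1 d (real m * z) \<le> real m * \<bar>z\<bar>"
        using sum_hat_off_origin[of "{d}" "real m * z"] \<open>d \<in> D\<close> fin by (auto simp: abs_mult)
      then have "hat 1 d (real m * z) * J \<bar>z\<bar> \<le> (real m * \<bar>z\<bar>) * M"
        using Jz[OF z] False by (intro mult_mono) auto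
      then show ?thesis
        using False Jz[OF z] hat_nonneg[of 1 d] by (simp add: g_def abs_mult field_simps)
    qed (simp add: g_def M0)
  qed
  have int_J: "set_integrable lebesgue {-1..1} (\<lambda>z. J \<bar>z\<bar> * \<bar>z\<bar>)"
  proof (rule int)
    show "(\<lambda>z. J \<bar>z\<bar> * \<bar>z\<bar>) \<in> borel_measurable lebesgue"
      using meas abs_meas by (intro borel_measurable_times)
    show "\<bar>J \<bar>z\<bar> * \<bar>z\<bar>\<bar> \<le> M" if z: "z \<in> {-1..1}" for z
    proof (cases "z = 0")
      case False
      then have "J \<bar>z\<bar> * \<bar>z\<bar> \<le> M * 1"
        using Jz[OF z] z by (intro mult_mono) auto
      then show ?thesis using Jz[OF z] by simp
    qed (simp add: M0)
  qed
  let ?I = "{- 1 / real m .. 1 / real m}"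
  have int_I: "set_integrable lebesgue {-1..1} (\<lambda>z. real m * M * indicator ?I z)"
  proof (rule int)
    show "(\<lambda>z. real m * M * indicator ?I z) \<in> borel_measurable lebesgue"
      by (intro measurable_completion) measurable
    show "\<bar>real m * M * indicator ?I z\<bar> \<le> real m * M" for z
      by (simp add: indicator_def M0)
  qed
  have I_sub: "?I \<inter> {-1..1} = ?I"
  proof -
    have "1 / real m \<le> 1" using \<open>m > 0\<close> by simp
    then show ?thesis by auto
  qed
  have LI: "(LINT z:{-1..1}|lebesgue. real m * M * indicator ?I z) = 2 * M"
  proof -
    have "(LINT z:{-1..1}|lebesgue. real m * M * indicator ?I z) = real m * M * (LINT z|lebesgue. indicator (?I \<inter> {-1..1}) z)"
      unfolding set_lebesgue_integral_def
      by (subst integral_mult_right_zero[symmetric]) (intro Bochner_Integration.integral_cong, auto simp: indicator_def)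
    also have "\<dots> = real m * M * (2 / real m)"
      unfolding I_sub by simp
    finally show ?thesis using \<open>m > 0\<close> by simp
  qed
  have pointwise: "(\<Sum>d\<in>D. g d z) \<le> (real m)\<^sup>2 * (J \<bar>z\<bar> * \<bar>z\<bar>) + real m * M * indicator ?I z"
    if z: "z \<in> {-1..1}" for z
  proof (cases "z = 0")
    case True
    \<comment> \<open>Division by 0 gives 0, so the integrand vanishes at the origin.\<close>
    then show ?thesis using M0 by (simp add: g_def)
  next
    case False
    have eq: "(\<Sum>d\<in>D. g d z) = (\<Sum>d\<in>D. hat 1 d (real m * z)) * (J \<bar>z\<bar> / \<bar>z\<bar>)"
      by (simp add: g_def sum_distrib_right sum_divide_distrib)
    have S: "(\<Sum>d\<in>D. hat 1 d (real m * z)) \<le> 1" "(\<Sum>d\<in>D. hat 1 d (real m * z)) \<le> real m * \<bar>z\<bar>"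
      using sum_hat_off_origin[OF fin, of "real m * z"] by (auto simp: abs_mult)
    have q: "0 \<le> J \<bar>z\<bar> / \<bar>z\<bar>" using Jz[OF z] by simp
    show ?thesis
    proof (cases "z \<in> ?I")
      case True
      have "(\<Sum>d\<in>D. g d z) \<le> real m * \<bar>z\<bar> * (J \<bar>z\<bar> / \<bar>z\<bar>)"
        unfolding eq by (rule mult_right_mono[OF S(2) q])
      also have "\<dots> = real m * J \<bar>z\<bar>" using False by simp
      also have "\<dots> \<le> real m * M" using Jz[OF z] False by (intro mult_left_mono) auto
      finally show ?thesis using True Jz[OF z] by (simp add: add_increasing)
    next
      case out: False
      then have "\<bar>z\<bar> > 1 / real m" by (auto simp: abs_if)
      then have "1 \<le> real m * \<bar>z\<bar>" using \<open>m > 0\<close> by (simp add: field_simps)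
      then have "1 \<le> (real m * \<bar>z\<bar>)\<^sup>2" by (rule one_le_power)
      have "(\<Sum>d\<in>D. g d z) \<le> 1 * (J \<bar>z\<bar> / \<bar>z\<bar>)"
        unfolding eq by (rule mult_right_mono[OF S(1) q])
      also have "\<dots> \<le> (real m * \<bar>z\<bar>)\<^sup>2 * (J \<bar>z\<bar> / \<bar>z\<bar>)"
        by (rule mult_right_mono) fact+
      also have "\<dots> = (real m)\<^sup>2 * (J \<bar>z\<bar> * \<bar>z\<bar>)"
        using False by (simp add: power2_eq_square)
      finally show ?thesis using out by simp
    qed
  qed
  have "(\<Sum>d\<in>D. bond_weight m J d) = (LINT z:{-1..1}|lebesgue. (\<Sum>d\<in>D. g d z))"
    unfolding bond_weight_def g_def[symmetric]
    using int_g unfolding set_lebesgue_integral_def set_integrable_def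
    by (simp add: sum_distrib_left Bochner_Integration.integral_sum)
  also have "\<dots> \<le> (LINT z:{-1..1}|lebesgue. (real m)\<^sup>2 * (J \<bar>z\<bar> * \<bar>z\<bar>) + real m * M * indicator ?I z)"
  proof (rule set_integral_mono)
    show "set_integrable lebesgue {-1..1} (\<lambda>z. \<Sum>d\<in>D. g d z)"
      using int_g unfolding set_integrable_def by (simp add: sum_distrib_left)
    show "set_integrable lebesgue {-1..1} (\<lambda>z. (real m)\<^sup>2 * (J \<bar>z\<bar> * \<bar>z\<bar>) + real m * M * indicator ?I z)"
      using int_J int_I by (intro set_integral_add) auto
  qed (rule pointwise)
  also have "\<dots> = (real m)\<^sup>2 * (LINT z:{-1..1}|lebesgue. J \<bar>z\<bar> * \<bar>z\<bar>) + 2 * M"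
  proof -
    have "set_integrable lebesgue {-1..1} (\<lambda>z. (real m)\<^sup>2 * (J \<bar>z\<bar> * \<bar>z\<bar>))"
      using int_J by simp
    from set_integral_add(2)[OF this int_I] show ?thesis
      unfolding LI unfolding set_integral_mult_right .
  qed
  finally show ?thesis .
qed

lemma bond_weight_nonneg:
  assumes "\<And>r. 0 \<le> r \<Longrightarrow> r \<le> 1 \<Longrightarrow> 0 \<le> J r"
  shows "bond_weight m J d \<ge> 0"
  unfolding bond_weight_def set_lebesgue_integral_def
  by (intro Bochner_Integration.integral_nonneg) (auto simp: indicator_def hat_nonneg intro!: divide_nonneg_nonneg mult_nonneg_nonneg assms)

section \<open>Eigenvalues of symmetric diagonally dominant matrices\<close>

text \<open>
  The Hermitian form \<open>Q\<close> of the matrix at the eigenvector equals \<open>\<mu>\<close> times the squared norm, and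
  conjugating \<open>Q\<close> only exchanges its two summation indices.
\<close>

lemma symmetric_eigenvalue_real:
  fixes a :: "'i \<Rightarrow> 'i \<Rightarrow> real" and v :: "'i \<Rightarrow> complex"
  assumes "finite I" and sym: "\<And>i j. i \<in> I \<Longrightarrow> j \<in> I \<Longrightarrow> a i j = a j i"
    and eig: "\<And>i. i \<in> I \<Longrightarrow> (\<Sum>j\<in>I. of_real (a i j) * v j) = \<mu> * v i"
    and nz: "\<exists>i\<in>I. v i \<noteq> 0"
  shows "\<mu> \<in> \<real>"
proof -
  define N where "N = (\<Sum>i\<in>I. (cmod (v i))\<^sup>2)"
  define Q where "Q = (\<Sum>i\<in>I. \<Sum>j\<in>I. of_real (a i j) * v j * cnj (v i))"
  have "N \<noteq> 0"
    using assms(1) nz unfolding N_def by (subst sum_nonneg_eq_0_iff) auto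
  have "\<mu> * of_real N = (\<Sum>i\<in>I. \<mu> * v i * cnj (v i))"
    by (simp add: N_def sum_distrib_left complex_norm_square mult.assoc flip: of_real_power)
  also have "\<dots> = Q"
    unfolding Q_def by (intro sum.cong) (simp_all add: eig[symmetric] sum_distrib_right)
  finally have Q: "\<mu> * of_real N = Q" .
  have "cnj Q = (\<Sum>i\<in>I. \<Sum>j\<in>I. of_real (a j i) * v i * cnj (v j))"
    unfolding Q_def cnj_sum using sym by (intro sum.cong) (simp_all add: mult_ac)
  also have "\<dots> = Q"
    unfolding Q_def by (rule sum.swap)
  finally have "cnj (\<mu> * of_real N) = \<mu> * of_real N"
    by (simp add: Q)
  then have "cnj \<mu> = \<mu>"
    using \<open>N \<noteq> 0\<close> by simp
  then show ?thesis
    by (simp add: Reals_cnj_iff)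
qed

text \<open>
  The disc is that of a row in which the eigenvector has an entry of largest norm: dividing the
  eigenvalue equation of this row by that entry leaves coefficients of norm at most 1.
\<close>

lemma gershgorin_disc:
  fixes a :: "'i \<Rightarrow> 'i \<Rightarrow> 'f::real_normed_field" and v :: "'i \<Rightarrow> 'f"
  assumes "finite I"
    and eig: "\<And>i. i \<in> I \<Longrightarrow> (\<Sum>j\<in>I. a i j * v j) = \<mu> * v i"
    and nz: "\<exists>i\<in>I. v i \<noteq> 0"
  shows "\<exists>i\<in>I. norm (\<mu> - a i i) \<le> (\<Sum>j\<in>I - {i}. norm (a i j))"
proof -
  obtain i where i: "i \<in> I" and max: "\<And>j. j \<in> I \<Longrightarrow> norm (v j) \<le> norm (v i)"
  proof -
    have ne: "I \<noteq> {}" using nz by auto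
    have "Max ((\<lambda>j. norm (v j)) ` I) \<in> (\<lambda>j. norm (v j)) ` I"
      using assms(1) ne by (intro Max_in) auto
    then obtain i where "i \<in> I" "norm (v i) = Max ((\<lambda>j. norm (v j)) ` I)" by auto
    with assms(1) that show thesis by (metis Max_ge finite_imageI imageI)
  qed
  have "norm (v i) > 0"
    using nz max by (auto intro: less_le_trans[rotated])
  have "(\<mu> - a i i) * v i = (\<Sum>j\<in>I - {i}. a i j * v j)"
    using eig[OF i] assms(1) i by (simp add: sum.remove algebra_simps)
  then have "norm (\<mu> - a i i) * norm (v i) = norm (\<Sum>j\<in>I - {i}. a i j * v j)"
    by (metis norm_mult)
  also have "\<dots> \<le> (\<Sum>j\<in>I - {i}. norm (a i j) * norm (v i))"
    by (intro sum_norm_le) (auto simp: norm_mult intro!: mult_left_mono max)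
  finally have "norm (\<mu> - a i i) * norm (v i) \<le> (\<Sum>j\<in>I - {i}. norm (a i j)) * norm (v i)"
    by (simp add: sum_distrib_right)
  then show ?thesis
    using \<open>norm (v i) > 0\<close> i by auto
qed

text \<open>
  A Gershgorin disc with centre \<open>a i i \<le> 0\<close> and radius at most \<open>- a i i\<close> meets the real axis inside
  \<open>[2 a i i, 0]\<close>.
\<close>

lemma dominant_eigenvalue_bounds:
  fixes a :: "'i \<Rightarrow> 'i \<Rightarrow> real" and v :: "'i \<Rightarrow> complex"
  assumes "finite I" and sym: "\<And>i j. i \<in> I \<Longrightarrow> j \<in> I \<Longrightarrow> a i j = a j i"
    and off: "\<And>i j. i \<in> I \<Longrightarrow> j \<in> I \<Longrightarrow> i \<noteq> j \<Longrightarrow> a i j \<ge> 0"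
    and dom: "\<And>i. i \<in> I \<Longrightarrow> (\<Sum>j\<in>I - {i}. a i j) \<le> - a i i"
    and S: "\<And>i. i \<in> I \<Longrightarrow> - a i i \<le> S"
    and eig: "\<And>i. i \<in> I \<Longrightarrow> (\<Sum>j\<in>I. of_real (a i j) * v j) = \<mu> * v i"
    and nz: "\<exists>i\<in>I. v i \<noteq> 0"
  obtains r where "\<mu> = of_real r" "- (2 * S) \<le> r" "r \<le> 0"
proof -
  obtain r where r: "\<mu> = of_real r"
    using symmetric_eigenvalue_real[OF assms(1) sym eig nz] by (auto elim: Reals_cases)
  obtain i where i: "i \<in> I" and disc: "norm (\<mu> - of_real (a i i)) \<le> (\<Sum>j\<in>I - {i}. cmod (of_real (a i j)))"
    using gershgorin_disc[OF assms(1) eig nz] by auto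
  have "(\<Sum>j\<in>I - {i}. cmod (of_real (a i j))) = (\<Sum>j\<in>I - {i}. a i j)"
    using i off by (intro sum.cong) auto
  with disc dom[OF i] have "\<bar>r - a i i\<bar> \<le> - a i i"
    unfolding r by (simp flip: of_real_diff)
  with S[OF i] show thesis
    by (intro that[OF r]) auto
qed

section \<open>The characteristic equation of the scheme\<close>

text \<open>
  Both roots are in fact on the unit circle: a nonreal root has real part \<open>s / 2\<close>, and its
  conjugate, the other root, is also its inverse; a real root \<open>x\<close> satisfies
  \<open>x\<^sup>2 + 1 \<le> 2 \<bar>x\<bar>\<close>, which forces \<open>\<bar>x\<bar> = 1\<close>.
\<close>

lemma characteristic_root_le_one:
  fixes \<xi> :: complex and s :: real
  assumes "\<xi>\<^sup>2 + 1 = of_real s * \<xi>" and "\<bar>s\<bar> \<le> 2"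
  shows "cmod \<xi> \<le> 1"
proof -
  define x y where "x = Re \<xi>" and "y = Im \<xi>"
  have re: "x\<^sup>2 - y\<^sup>2 + 1 = s * x" and im: "2 * x * y = s * y"
    using arg_cong[OF assms(1), of Re] arg_cong[OF assms(1), of Im]
    by (simp_all add: x_def y_def power2_eq_square)
  have "x\<^sup>2 + y\<^sup>2 = 1"
  proof (cases "y = 0")
    case False
    then have "s = 2 * x" using im by simp
    then show ?thesis using re by (simp add: power2_eq_square)
  next
    case True
    have "s * x \<le> \<bar>s\<bar> * \<bar>x\<bar>"
      by (simp flip: abs_mult)
    also have "\<dots> \<le> 2 * \<bar>x\<bar>"
      using assms(2) by (intro mult_right_mono) auto
    finally have "s * x \<le> 2 * \<bar>x\<bar>" .
    then have "(\<bar>x\<bar> - 1)\<^sup>2 \<le> 0"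
      using re True by (simp add: power2_diff)
    then have "\<bar>x\<bar> = 1" by simp
    then have "x\<^sup>2 = 1" using power2_abs[of x] by simp
    then show ?thesis using True by simp
  qed
  then show ?thesis
    by (simp add: cmod_def x_def y_def)
qed

text \<open>
  The step from times 0 and 1 to time 2 already gives the equation, read off at a nonzero entry of
  the eigenvector.
\<close>

lemma scheme_characteristic_equation:
  assumes A: "A \<in> carrier_mat n n" and ev: "eigenvector A \<nu> \<mu>"
    and sol: "solves_central_difference \<Delta>t A (\<lambda>k. \<xi> ^ k \<cdot>\<^sub>v \<nu>)"
  shows "\<xi>\<^sup>2 + 1 = (2 + of_real (\<Delta>t\<^sup>2) * \<mu>) * \<xi>"
proof -
  have \<nu>: "\<nu> \<in> carrier_vec n" "\<nu> \<noteq> 0\<^sub>v n" "A *\<^sub>v \<nu> = \<mu> \<cdot>\<^sub>v \<nu>"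
    using ev A by (auto simp: eigenvector_def)
  then obtain i where i: "i < n" "vec_index \<nu> i \<noteq> 0"
    by (metis carrier_vecD eq_vecI index_zero_vec)
  have smult_mat_vec: "(k \<cdot>\<^sub>m B) *\<^sub>v w = k \<cdot>\<^sub>v (B *\<^sub>v w)"
    if "B \<in> carrier_mat n n" "w \<in> carrier_vec n" for k :: complex and B w
    using that by (intro eq_vecI) (auto simp: scalar_prod_def sum_distrib_left mult.assoc)
  have Av: "(2 \<cdot>\<^sub>m 1\<^sub>m n + complex_of_real (\<Delta>t\<^sup>2) \<cdot>\<^sub>m A) *\<^sub>v (\<xi> \<cdot>\<^sub>v \<nu>)
      = (2 * \<xi>) \<cdot>\<^sub>v \<nu> + (complex_of_real (\<Delta>t\<^sup>2) * \<mu> * \<xi>) \<cdot>\<^sub>v \<nu>"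
  proof -
    have "(2 \<cdot>\<^sub>m 1\<^sub>m n + complex_of_real (\<Delta>t\<^sup>2) \<cdot>\<^sub>m A) *\<^sub>v (\<xi> \<cdot>\<^sub>v \<nu>)
        = (2 \<cdot>\<^sub>m 1\<^sub>m n) *\<^sub>v (\<xi> \<cdot>\<^sub>v \<nu>) + (complex_of_real (\<Delta>t\<^sup>2) \<cdot>\<^sub>m A) *\<^sub>v (\<xi> \<cdot>\<^sub>v \<nu>)"
      using A \<nu>(1) by (intro add_mult_distrib_mat_vec[of _ n n]) auto
    also have "(2 \<cdot>\<^sub>m 1\<^sub>m n) *\<^sub>v (\<xi> \<cdot>\<^sub>v \<nu>) = (2 * \<xi>) \<cdot>\<^sub>v \<nu>"
      using \<nu>(1) by (simp add: smult_mat_vec smult_smult_assoc)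
    also have "(complex_of_real (\<Delta>t\<^sup>2) \<cdot>\<^sub>m A) *\<^sub>v (\<xi> \<cdot>\<^sub>v \<nu>) = complex_of_real (\<Delta>t\<^sup>2) \<cdot>\<^sub>v (\<xi> \<cdot>\<^sub>v (\<mu> \<cdot>\<^sub>v \<nu>))"
      using A \<nu> by (simp add: smult_mat_vec mult_mat_vec[of _ n n] smult_smult_assoc mult_ac)
    finally show ?thesis
      by (simp add: smult_smult_assoc mult_ac)
  qed
  have "\<xi> ^ 2 \<cdot>\<^sub>v \<nu> = - (\<xi> ^ 0 \<cdot>\<^sub>v \<nu>) + ((2 * \<xi>) \<cdot>\<^sub>v \<nu> + (complex_of_real (\<Delta>t\<^sup>2) * \<mu> * \<xi>) \<cdot>\<^sub>v \<nu>)"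
    using sol[unfolded solves_central_difference_def, rule_format, of 1] A Av by (simp add: numeral_2_eq_2)
  from arg_cong[OF this, of "\<lambda>u. vec_index u i"]
  have "\<xi>\<^sup>2 * vec_index \<nu> i = (- 1 + 2 * \<xi> + of_real (\<Delta>t\<^sup>2) * \<mu> * \<xi>) * vec_index \<nu> i"
    using i \<nu>(1) by (simp add: algebra_simps)
  then have "\<xi>\<^sup>2 = - 1 + 2 * \<xi> + of_real (\<Delta>t\<^sup>2) * \<mu> * \<xi>"
    using i(2) by simp
  then show ?thesis
    by (simp add: algebra_simps)
qed

section \<open>Stability\<close>

lemma finite_mesh_indices:
  assumes "h > 0" "bounded S"
  shows "finite (mesh_indices h S)"
proof -
  obtain B where B: "\<And>x. x \<in> closure S \<Longrightarrow> \<bar>x\<bar> \<le> B"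
    using bounded_closure[OF assms(2)] by (auto simp: bounded_iff)
  have "mesh_indices h S \<subseteq> {\<lfloor>- B / h\<rfloor> .. \<lceil>B / h\<rceil>}"
  proof
    fix i assume "i \<in> mesh_indices h S"
    then have "\<bar>of_int i * h\<bar> \<le> B"
      using B by (simp add: mesh_indices_def)
    then have "- B / h \<le> of_int i" "of_int i \<le> B / h"
      using assms(1) by (auto simp: field_simps abs_le_iff)
    then show "i \<in> {\<lfloor>- B / h\<rfloor> .. \<lceil>B / h\<rceil>}"
      by simp linarith
  qed
  then show ?thesis
    by (rule finite_subset) simp
qed

theorem theorem3:
  fixes a b h \<epsilon> c M L \<Delta>t :: real and m :: nat and f J :: "real \<Rightarrow> real"
  assumes "a < b" and "h > 0" and "m > 0" and "\<epsilon> = real m * h"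
    and "union_of_mesh_elements h (closure {a..b})"
    and "union_of_mesh_elements h (closure (boundary_layer a b \<epsilon>))"
    and "\<And>r. r > 0 \<Longrightarrow> f r > 0"
    and "smooth_on_halfline f"
    and "concave_on {0..} f"
    and "(f has_real_derivative c) (at 0 within {0..})"
    and "((\<lambda>r. f r / r) \<longlongrightarrow> c) (at_right 0)"
    and "(f \<longlongrightarrow> L) at_top"
    and "(\<lambda>\<xi>. J \<bar>\<xi>\<bar>) \<in> borel_measurable lebesgue"
    and "\<And>\<xi>. \<xi> \<in> {-1..1} \<Longrightarrow> J \<bar>\<xi>\<bar> \<ge> 0"
    and "bounded ((\<lambda>\<xi>. J \<bar>\<xi>\<bar>) ` {-1..1})"
    and "\<And>\<xi>. \<xi> \<notin> {-1..1} \<Longrightarrow> J \<bar>\<xi>\<bar> = 0"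
    and "elastic_constant c J > 0"
    and "M = (SUP r\<in>{0<..1}. J r)"
    and "\<Delta>t > 0"
    and "\<Delta>t \<le> h / sqrt (elastic_constant c J + 2 * c * (M * h\<^sup>2 / \<epsilon>\<^sup>2))"
  shows "central_difference_stable \<Delta>t (stiffness_matrix c J a b h \<epsilon>)"
proof -
  define K where "K = mesh_indices h {a..b}"
  define K' where "K' = mesh_indices h (boundary_layer a b \<epsilon>)"
  define n where "n = card K"
  define node where "node r = sorted_list_of_set K ! r" for r
  define e where "e r s = stiffness_entry c J h \<epsilon> K K' (node r) (node s)" for r s
  define Q where "Q = elastic_constant c J + 2 * c * (M * h\<^sup>2 / \<epsilon>\<^sup>2)"
  define P where "P = (LINT z:{-1..1}|lebesgue. J \<bar>z\<bar> * \<bar>z\<bar>)"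
  have h: "h > 0" and \<epsilon>: "\<epsilon> > 0"
    using assms(2-4) by auto
  have finK: "finite K" "finite K'"
    unfolding K_def K'_def boundary_layer_def using h by (auto intro!: finite_mesh_indices)
  have J: "0 \<le> J r" if "0 \<le> r" "r \<le> 1" for r
    using assms(14)[of r] that by auto
  have M: "J r \<le> M" if "0 < r" "r \<le> 1" for r
  proof -
    have "J ` {0<..1} = (\<lambda>\<xi>. J \<bar>\<xi>\<bar>) ` {0<..1}"
      by (intro image_cong) auto
    also have "\<dots> \<subseteq> (\<lambda>\<xi>. J \<bar>\<xi>\<bar>) ` {-1..1}"
      by (intro image_mono) auto
    finally have "J ` {0<..1} \<subseteq> (\<lambda>\<xi>. J \<bar>\<xi>\<bar>) ` {-1..1}" .
    then have "bdd_above (J ` {0<..1})"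
      by (rule bounded_imp_bdd_above[OF bounded_subset[OF assms(15)]])
    then show ?thesis
      unfolding assms(18) using that by (intro cSUP_upper) auto
  qed
  have "M \<ge> 0"
    using J[of 1] M[of 1] by simp
  have C: "elastic_constant c J = c * P"
    unfolding elastic_constant_def P_def by (subst set_integral_mult_right[symmetric]) (simp add: mult_ac)
  have "P \<ge> 0"
    unfolding P_def set_lebesgue_integral_def
    by (intro Bochner_Integration.integral_nonneg) (auto simp: indicator_def intro!: J mult_nonneg_nonneg)
  \<comment> \<open>The sign of \<open>c\<close> follows from the positivity of the elastic constant.\<close>
  with C assms(17) have "c > 0"
    by (metis not_less mult_nonpos_nonneg)
  have Q: "Q > 0"
    unfolding Q_def using assms(17) \<open>c > 0\<close> \<open>M \<ge> 0\<close> by (intro add_pos_nonneg) auto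
  have abar: "abar c J h \<epsilon> i j = 2 / \<epsilon>\<^sup>2 * c * bond_weight m J (j - i)" for i j
    using abar_eq_bond_weight assms(2-4) by blast
  have abar_nonneg: "abar c J h \<epsilon> i j \<ge> 0" for i j
    unfolding abar using \<open>c > 0\<close> bond_weight_nonneg[of J m "j - i"] J by simp
  have abar_sym: "abar c J h \<epsilon> i j = abar c J h \<epsilon> j i" for i j
    unfolding abar using bond_weight_even[of m J "i - j"] by simp
  \<comment> \<open>The factor \<open>\<epsilon>\<^sup>2 = m\<^sup>2 h\<^sup>2\<close> turns the bound on the sum of bond weights into a multiple of \<open>Q\<close>.\<close>
  have row_sum: "(\<Sum>k\<in>(K \<union> K') - {i}. abar c J h \<epsilon> i k) \<le> 2 * Q / h\<^sup>2" for i
  proof -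
    have inj: "inj_on (\<lambda>k. k - i) ((K \<union> K') - {i})"
      by (auto simp: inj_on_def)
    have "(\<Sum>k\<in>(K \<union> K') - {i}. abar c J h \<epsilon> i k)
        = 2 / \<epsilon>\<^sup>2 * c * (\<Sum>d\<in>(\<lambda>k. k - i) ` ((K \<union> K') - {i}). bond_weight m J d)"
      unfolding abar by (simp add: sum.reindex[OF inj] sum_distrib_left)
    also have "\<dots> \<le> 2 / \<epsilon>\<^sup>2 * c * ((real m)\<^sup>2 * P + 2 * M)"
      unfolding P_def using \<open>c > 0\<close> finK
      by (intro mult_left_mono sum_bond_weight_le assms J M) auto
    also have "\<dots> = 2 * Q / h\<^sup>2"
      using h \<open>m > 0\<close> unfolding Q_def C assms(4) by (simp add: field_simps power2_eq_square)
    finally show ?thesis .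
  qed
  have bij: "bij_betw node {..<n} K"
    using bij_betw_nth[of "sorted_list_of_set K" "{..<n}" K] finK
    by (simp add: node_def[abs_def] n_def)
  have node_eq: "node r = node s \<longleftrightarrow> r = s" if "r \<in> {..<n}" "s \<in> {..<n}" for r s
    using bij that by (metis bij_betw_def inj_on_eq_iff)
  have diag: "e r r = - (\<Sum>k\<in>(K \<union> K') - {node r}. abar c J h \<epsilon> (node r) k)" for r
    by (simp add: e_def stiffness_entry_def)
  have off: "e r s = abar c J h \<epsilon> (node r) (node s)" if "r \<in> {..<n}" "s \<in> {..<n}" "r \<noteq> s" for r s
    using node_eq[of r s] that by (auto simp: e_def stiffness_entry_def)
  have dom: "(\<Sum>s\<in>{..<n} - {r}. e r s) \<le> - e r r" if r: "r \<in> {..<n}" for r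
  proof -
    have bij': "bij_betw node ({..<n} - {r}) (K - {node r})"
      using bij_betw_DiffI[OF bij, of "{r}" "{node r}"] r bij by (auto simp: bij_betw_def)
    have "(\<Sum>s\<in>{..<n} - {r}. e r s) = (\<Sum>s\<in>{..<n} - {r}. abar c J h \<epsilon> (node r) (node s))"
      using r by (intro sum.cong) (auto simp: off)
    also have "\<dots> = (\<Sum>k\<in>K - {node r}. abar c J h \<epsilon> (node r) k)"
      by (rule sum.reindex_bij_betw[OF bij'])
    also have "\<dots> \<le> - e r r"
      unfolding diag minus_minus using finK by (intro sum_mono2 abar_nonneg) auto
    finally show ?thesis .
  qed
  have mat: "stiffness_matrix c J a b h \<epsilon> = Matrix.mat n n (\<lambda>(r, s). e r s)"
    by (simp add: stiffness_matrix_def Let_def K_def K'_def n_def node_def e_def)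
  show ?thesis
    unfolding central_difference_stable_def Let_def
  proof (intro allI impI)
    fix \<nu> \<mu> \<xi>
    let ?A = "map_mat complex_of_real (stiffness_matrix c J a b h \<epsilon>)"
    assume ev: "eigenvector ?A \<nu> \<mu>" and sol: "solves_central_difference \<Delta>t ?A (\<lambda>k. \<xi> ^ k \<cdot>\<^sub>v \<nu>)"
    have A: "?A \<in> carrier_mat n n"
      by (simp add: mat)
    have \<nu>: "\<nu> \<in> carrier_vec n" "\<nu> \<noteq> 0\<^sub>v n" "?A *\<^sub>v \<nu> = \<mu> \<cdot>\<^sub>v \<nu>"
      using ev A by (auto simp: eigenvector_def)
    have nz: "\<exists>r\<in>{..<n}. vec_index \<nu> r \<noteq> 0"
      using \<nu>(1,2) by (metis carrier_vecD eq_vecI index_zero_vec lessThan_iff)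
    have eig: "(\<Sum>s\<in>{..<n}. of_real (e r s) * vec_index \<nu> s) = \<mu> * vec_index \<nu> r" if "r \<in> {..<n}" for r
      using arg_cong[OF \<nu>(3), of "\<lambda>u. vec_index u r"] that \<nu>(1)
      by (simp add: mat scalar_prod_def lessThan_atLeast0)
    obtain t where t: "\<mu> = of_real t" "- (2 * (2 * Q / h\<^sup>2)) \<le> t" "t \<le> 0"
    proof (rule dominant_eigenvalue_bounds[of "{..<n}" e "2 * Q / h\<^sup>2" "vec_index \<nu>" \<mu>])
      show "e r s = e s r" if "r \<in> {..<n}" "s \<in> {..<n}" for r s
        using that off abar_sym by (cases "r = s") auto
      show "e r s \<ge> 0" if "r \<in> {..<n}" "s \<in> {..<n}" "r \<noteq> s" for r s
        using that off abar_nonneg by simp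
      show "- e r r \<le> 2 * Q / h\<^sup>2" if "r \<in> {..<n}" for r
        unfolding diag minus_minus by (rule row_sum)
    qed (use dom eig nz in auto)
    \<comment> \<open>The time step is small enough to confine \<open>\<Delta>t\<^sup>2 t\<close> to \<open>[-4, 0]\<close>.\<close>
    have "\<Delta>t\<^sup>2 \<le> (h / sqrt Q)\<^sup>2"
      using assms(19,20) unfolding Q_def by (intro power_mono) auto
    then have dt: "\<Delta>t\<^sup>2 \<le> h\<^sup>2 / Q"
      using Q by (simp add: power_divide)
    have "\<Delta>t\<^sup>2 * (- t) \<le> h\<^sup>2 / Q * (2 * (2 * Q / h\<^sup>2))"
      using dt t Q by (intro mult_mono) auto
    also have "\<dots> = 4"
      using Q h by simp
    finally have "\<bar>2 + \<Delta>t\<^sup>2 * t\<bar> \<le> 2"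
      using t(3) by (simp add: abs_le_iff mult_nonneg_nonpos)
    then show "cmod \<xi> \<le> 1"
      using scheme_characteristic_equation[OF A ev sol] t(1)
      by (intro characteristic_root_le_one[of \<xi> "2 + \<Delta>t\<^sup>2 * t"]) simp_all
  qed
qed

end
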